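(* Any SR instance with $n$ agents admits at most $O(n_1^2+n_2)=O(n^2)$ stable cycles, where $n_2=\vert A(\mathcal{O}_I)\vert$ and $n_1=n-n_2$.
   Context: An SR (Stable Roommates) instance $I=(A,\succ)$ consists of an even number $n$ of agents, each with a strict complete preference ranking over the other agents. A stable partition is a permutation $\Pi$ of $A$ such that (T1) every agent weakly prefers its successor to its predecessor, and (T2) no two distinct agents $a_i,a_j$ satisfy $a_j \succ_i \Pi^{-1}(a_i)$ and $a_i \succ_j \Pi^{-1}(a_j)$. A stable cycle is a cycle contained in some stable partition of $I$. $\mathcal{O}_I$ denotes the odd-length cycles, which are the same in every stable partition of $I$, and $A(\mathcal{O}_I)$ the set of agents in them. *)

theory Defs
  imports Complex_Main "HOL-Combinatorics.Combinatorics"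
begin

text \<open>
  An instance is a finite set \<open>A\<close> of agents together with one relation \<open>R a\<close> per agent:
  \<open>(b, c) \<in> R a\<close> means that \<open>a\<close> strictly prefers \<open>b\<close> to \<open>c\<close>.
\<close>

definition sr_instance :: "'a set \<Rightarrow> ('a \<Rightarrow> 'a rel) \<Rightarrow> bool" where
  "sr_instance A R \<longleftrightarrow> finite A \<and> even (card A) \<and>
     (\<forall>a\<in>A. R a \<subseteq> (A - {a}) \<times> (A - {a}) \<and> strict_linear_order_on (A - {a}) (R a))"

text \<open>
  A stable partition may have fixed points, so an agent may have to compare others with itself.
  The convention for stable partitions is that every agent ranks itself last.
\<close>

definition prefers :: "'a set \<Rightarrow> ('a \<Rightarrow> 'a rel) \<Rightarrow> 'a \<Rightarrow> 'a \<Rightarrow> 'a \<Rightarrow> bool" where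
  "prefers A R a b c \<longleftrightarrow> (b, c) \<in> R a \<or> (b \<in> A - {a} \<and> c = a)"

definition weakly_prefers :: "'a set \<Rightarrow> ('a \<Rightarrow> 'a rel) \<Rightarrow> 'a \<Rightarrow> 'a \<Rightarrow> 'a \<Rightarrow> bool" where
  "weakly_prefers A R a b c \<longleftrightarrow> b = c \<or> prefers A R a b c"

definition stable_partition :: "'a set \<Rightarrow> ('a \<Rightarrow> 'a rel) \<Rightarrow> ('a \<Rightarrow> 'a) \<Rightarrow> bool" where
  "stable_partition A R p \<longleftrightarrow> p permutes A \<and>
     (\<forall>a\<in>A. weakly_prefers A R a (p a) (inv p a)) \<and>
     \<not> (\<exists>a\<in>A. \<exists>b\<in>A. a \<noteq> b \<and> prefers A R a b (inv p a) \<and> prefers A R b a (inv p b))"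

text \<open>
  A cycle is represented by the set of its arcs \<open>(x, p x)\<close>. This identifies cyclic sequences up to
  rotation, keeps the two orientations of a cycle of length at least three apart, and keeps fixed
  points of different agents apart. The length of a cycle \<open>c\<close> is \<open>card c\<close>, and its agents
  are \<open>Field c\<close>.
\<close>

definition cycles_of :: "'a set \<Rightarrow> ('a \<Rightarrow> 'a) \<Rightarrow> 'a rel set" where
  "cycles_of A p = (\<lambda>a. {(x, p x) | x. x \<in> orbit p a}) ` A"

definition stable_cycles :: "'a set \<Rightarrow> ('a \<Rightarrow> 'a rel) \<Rightarrow> 'a rel set" where
  "stable_cycles A R = {c. \<exists>p. stable_partition A R p \<and> c \<in> cycles_of A p}"

text \<open>
  All stable partitions of an instance have the same odd cycles, so \<open>odd_cycles A R\<close> is the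
  set of odd cycles of any one of them. Fixed points are cycles of length one and hence odd.
\<close>

definition odd_cycles :: "'a set \<Rightarrow> ('a \<Rightarrow> 'a rel) \<Rightarrow> 'a rel set" where
  "odd_cycles A R = {c \<in> stable_cycles A R. odd (card c)}"

definition odd_cycle_agents :: "'a set \<Rightarrow> ('a \<Rightarrow> 'a rel) \<Rightarrow> 'a set" where
  "odd_cycle_agents A R = (\<Union>c\<in>odd_cycles A R. Field c)"

text \<open>
  The following facts ensure that the cardinalities and the subtraction \<open>card A - n2\<close> on
  natural numbers have their intended meaning.
\<close>

lemma stable_cycle_subset:
  assumes "c \<in> stable_cycles A R"
  shows "c \<subseteq> A \<times> A"
proof -
  obtain p a where p: "p permutes A" and a: "a \<in> A"
    and c: "c = {(x, p x) | x. x \<in> orbit p a}"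
    using assms by (auto simp: stable_cycles_def stable_partition_def cycles_of_def)
  have "orbit p a \<subseteq> A"
    using p a by (rule permutes_orbit_subset)
  then show ?thesis
    using c p by (auto simp: permutes_in_image)
qed

lemma finite_stable_cycles: "finite A \<Longrightarrow> finite (stable_cycles A R)"
  by (rule finite_subset[of _ "Pow (A \<times> A)"]) (auto dest: stable_cycle_subset)

lemma odd_cycle_agents_subset: "odd_cycle_agents A R \<subseteq> A"
  by (fastforce simp: odd_cycle_agents_def odd_cycles_def Field_def dest: stable_cycle_subset)

end

theory Submission
  imports Defs
begin

text \<open>
  Give every agent \<open>a\<close> of a stable partition \<open>p\<close> the partner \<open>p a\<close> in one role and
  \<open>inv p a\<close> in the other: this is a stable matching of the bipartite double cover of the
  instance. If \<open>p\<close> and \<open>q\<close> are stable partitions, the usual counting argument for two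
  stable matchings shows that \<open>p\<close> and \<open>q\<close> both map the agents with \<open>p a\<close> better than
  \<open>q a\<close> onto those with \<open>inv q a\<close> better than \<open>inv p a\<close>. Together with condition (T2) it
  follows that on a cycle of \<open>p\<close> of length at least three the property
  ``\<open>p a\<close> is better than \<open>q a\<close>'' propagates backwards in steps of two. Hence it never holds if
  the cycle is odd, which forces \<open>q = p\<close> there; and if \<open>p\<close> and \<open>q\<close> share an arc that lies on
  cycles of length at least three in both, propagation around the cycle
  shows that they share the whole cycle. So odd cycles are pairwise disjoint, and an even cycle is
  determined by any of its arcs, up to the distinction between length two and length at least four;
  its agents lie on no odd cycle.
\<close>

subsection \<open>Permutations\<close>

text \<open>The iterates below the first return time enumerate the orbit injectively, so its
  cardinality is that return time.\<close>

lemma funpow_card_orbit: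
  assumes "a \<in> orbit f a"
  shows "(f ^^ card (orbit f a)) a = a"
proof -
  have "card (orbit f a) = card {0..<funpow_dist1 f a a}"
    by (metis assms card_image inj_on_funpow_dist1 orbit_conv_funpow_dist1)
  then show ?thesis
    using funpow_dist1_prop[OF assms] by simp
qed

lemma card_orbit_involutive:
  assumes "p (p a) = a"
  shows "card (orbit p a) \<le> 2"
proof -
  have "orbit p a \<subseteq> {a, p a}"
  proof
    fix x assume "x \<in> orbit p a"
    then show "x \<in> {a, p a}"
      by induct (auto simp: assms)
  qed
  then have "card (orbit p a) \<le> card {a, p a}"
    by (intro card_mono) auto
  also have "\<dots> \<le> 2"
    by (simp add: card_insert_if)
  finally show ?thesis .
qed

lemma card_orbit_graph: "card {(x, p x) | x. x \<in> orbit p a} = card (orbit p a)"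
proof -
  have "{(x, p x) | x. x \<in> orbit p a} = (\<lambda>x. (x, p x)) ` orbit p a"
    by auto
  then show ?thesis
    by (simp add: card_image inj_on_def)
qed

subsection \<open>Stable partitions in terms of ranks\<close>

text \<open>Larger values of \<open>u a b\<close> mean that \<open>a\<close> likes \<open>b\<close>
  more. Injectivity encodes strict complete preferences, and \<open>self_least\<close> the
  convention that agents rank themselves last.\<close>

locale ranking =
  fixes A :: "'a set" and u :: "'a \<Rightarrow> 'a \<Rightarrow> nat"
  assumes finite_A: "finite A"
    and inj_u: "a \<in> A \<Longrightarrow> inj_on (u a) A"
    and self_least: "a \<in> A \<Longrightarrow> b \<in> A \<Longrightarrow> u a a \<le> u a b"
begin

definition stable :: "('a \<Rightarrow> 'a) \<Rightarrow> bool" where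
  "stable p \<longleftrightarrow> p permutes A \<and> (\<forall>a\<in>A. u a (inv p a) \<le> u a (p a)) \<and>
     (\<forall>a\<in>A. \<forall>b\<in>A. u a (inv p a) < u a b \<longrightarrow> u b a \<le> u b (inv p b))"

lemma u_eq_iff: "a \<in> A \<Longrightarrow> b \<in> A \<Longrightarrow> c \<in> A \<Longrightarrow> u a b = u a c \<longleftrightarrow> b = c"
  using inj_u by (auto dest: inj_onD)

lemma stable_permutes: "stable p \<Longrightarrow> p permutes A"
  by (simp add: stable_def)

lemma stable_in [simp]: "stable p \<Longrightarrow> p a \<in> A \<longleftrightarrow> a \<in> A"
  by (metis permutes_in_image stable_permutes)

lemma stable_inv_in [simp]: "stable p \<Longrightarrow> inv p a \<in> A \<longleftrightarrow> a \<in> A"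
  by (metis permutes_in_image permutes_inv stable_permutes)

lemma stable_inv_simps [simp]: "stable p \<Longrightarrow> inv p (p a) = a" "stable p \<Longrightarrow> p (inv p a) = a"
  by (metis permutes_inverses stable_permutes)+

lemma stable_T1: "stable p \<Longrightarrow> a \<in> A \<Longrightarrow> u a (inv p a) \<le> u a (p a)"
  by (simp add: stable_def)

lemma stable_T2:
  "stable p \<Longrightarrow> a \<in> A \<Longrightarrow> b \<in> A \<Longrightarrow> u a (inv p a) < u a b \<Longrightarrow> u b a \<le> u b (inv p b)"
  unfolding stable_def by blast

lemma stable_self_in_orbit: "stable p \<Longrightarrow> a \<in> orbit p a"
  using finite_A stable_permutes permutation_permutes permutation_self_in_orbit by metis

section \<open>Comparison of two stable partitions\<close>

definition above :: "('a \<Rightarrow> 'a) \<Rightarrow> ('a \<Rightarrow> 'a) \<Rightarrow> 'a set" where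
  "above p q = {a \<in> A. u a (q a) < u a (p a)}"

text \<open>By (T1), an agent \<open>a\<close> in \<open>above p q\<close> prefers
  \<open>p a\<close> to \<open>inv q a\<close>, so (T2) for \<open>q\<close> makes
  \<open>p a\<close> prefer its \<open>q\<close>-predecessor to \<open>a\<close>; the agents that
  gain in this way form \<open>above (inv q) (inv p)\<close>. Conversely, (T2) for \<open>p\<close>
  makes \<open>inv q\<close> map that set back. Two injections in opposite directions between finite
  sets are onto.\<close>

lemma image_above:
  assumes p: "stable p" and q: "stable q"
  shows "p ` above p q = above (inv q) (inv p)" "q ` above p q = above (inv q) (inv p)"
proof -
  let ?S = "above p q" and ?T = "above (inv q) (inv p)"
  have fin: "finite ?S" "finite ?T"
    using finite_A by (simp_all add: above_def)
  have S: "p ` ?S \<subseteq> ?T"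
  proof
    fix y assume "y \<in> p ` ?S"
    then obtain a where a: "a \<in> A" "u a (q a) < u a (p a)" and y: "y = p a"
      by (auto simp: above_def)
    have "u a (inv q a) < u a (p a)"
      using a stable_T1[OF q] by (meson le_less_trans)
    then have "u y a \<le> u y (inv q y)"
      using stable_T2[OF q] a(1) y p by simp
    moreover have "a \<noteq> inv q y"
      using a q y by (metis less_irrefl stable_inv_simps(2))
    ultimately show "y \<in> ?T"
      using a(1) y p q by (auto simp: above_def order_less_le u_eq_iff)
  qed
  have T: "inv q ` ?T \<subseteq> ?S"
  proof
    fix x assume "x \<in> inv q ` ?T"
    then obtain y where y: "y \<in> A" "u y (inv p y) < u y (inv q y)" and x: "x = inv q y"
      by (auto simp: above_def)
    have "u x y \<le> u x (inv p x)"
      using stable_T2[OF p] y x q by simp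
    then have "u x y \<le> u x (p x)"
      using stable_T1[OF p, of x] x y q by simp
    moreover have "y \<noteq> p x"
      using y p x by (metis less_irrefl stable_inv_simps(1))
    ultimately show "x \<in> ?S"
      using x y p q by (auto simp: above_def order_less_le u_eq_iff)
  qed
  have inj: "inj p" "inj (inv q)"
    using p q by (metis injI stable_inv_simps)+
  have cS: "card (p ` ?S) = card ?S" and cT: "card (inv q ` ?T) = card ?T"
    using inj by (meson card_image inj_on_subset subset_UNIV)+
  have "card ?S = card ?T"
    using card_mono[OF fin(2) S] card_mono[OF fin(1) T] cS cT by simp
  then show "p ` ?S = ?T"
    using card_subset_eq[OF fin(2) S] cS by simp
  have "inv q ` ?T = ?S"
    using card_subset_eq[OF fin(1) T] cT \<open>card ?S = card ?T\<close> by simp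
  then have "q ` inv q ` ?T = q ` ?S"
    by simp
  then show "q ` ?S = ?T"
    using q by (simp add: image_image)
qed

lemma succ_above_iff:
  assumes "stable p" "stable q"
  shows "p a \<in> above (inv q) (inv p) \<longleftrightarrow> a \<in> above p q"
    and "q a \<in> above (inv q) (inv p) \<longleftrightarrow> a \<in> above p q"
  using image_above[OF assms] assms by (metis (no_types, lifting) imageE imageI stable_inv_simps(1))+

text \<open>Otherwise \<open>a\<close> and \<open>q a\<close> would violate (T2) for
  \<open>p\<close>: by \<open>succ_above_iff\<close>, \<open>q a\<close> strictly prefers
  \<open>a\<close> to its \<open>p\<close>-predecessor.\<close>

lemma above_le_pred:
  assumes p: "stable p" and q: "stable q" and a: "a \<in> above p q"
  shows "u a (q a) \<le> u a (inv p a)"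
proof (rule ccontr)
  assume "\<not> ?thesis"
  then have "u (q a) a \<le> u (q a) (inv p (q a))"
    using stable_T2[OF p] a q by (simp add: above_def)
  moreover have "u (q a) (inv p (q a)) < u (q a) a"
    using succ_above_iff(2)[OF p q, of a] a q by (simp add: above_def)
  ultimately show False
    by simp
qed

text \<open>On the path \<open>a\<close>, \<open>?d\<close>, \<open>?b\<close>, the agent
  \<open>?b\<close> likes \<open>?d\<close> at least as much as \<open>q ?b\<close>. By (T2) for
  \<open>q\<close>, \<open>?d\<close> then likes \<open>inv q ?d\<close> at least as much as
  \<open>?b\<close>, hence by (T1) for \<open>p\<close> strictly more than \<open>a\<close>. This
  last strictness is where \<open>ne\<close> enters.\<close>

lemma above_back_two:
  assumes p: "stable p" and q: "stable q" and ne: "p (p a) \<noteq> a" and above: "p (p a) \<in> above p q"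
  shows "a \<in> above p q"
proof -
  let ?b = "p (p a)" and ?d = "p a"
  have b: "?b \<in> A" and d: "?d \<in> A" and a: "a \<in> A"
    using above p by (auto simp: above_def)
  have le: "u ?b (q ?b) \<le> u ?b ?d"
    using above_le_pred[OF p q above] p by simp
  have "u ?d ?b \<le> u ?d (inv q ?d)"
  proof (cases "q ?b = ?d")
    case True
    then show ?thesis
      using q by (metis order_refl stable_inv_simps(1))
  next
    case False
    then have "u ?b (q ?b) < u ?b ?d"
      using le b d q u_eq_iff[of ?b "q ?b" ?d] by auto
    then have "u ?b (inv q ?b) < u ?b ?d"
      using stable_T1[OF q b] by simp
    then show ?thesis
      using stable_T2[OF q b d] by simp
  qed
  moreover have "u ?d a < u ?d ?b"
    using stable_T1[OF p d] ne p u_eq_iff[of ?d a ?b] a b d by auto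
  ultimately have "?d \<in> above (inv q) (inv p)"
    using p d by (simp add: above_def)
  then show ?thesis
    using succ_above_iff(1)[OF p q] by simp
qed

section \<open>Propagation along a cycle\<close>

lemma funpow_period_two:
  assumes "stable p" "p (p ((p ^^ n) a)) = (p ^^ n) a"
  shows "p (p a) = a"
proof -
  have "(p ^^ n) (p (p a)) = (p ^^ n) a"
    using assms(2) by (metis funpow_swap1)
  moreover have "inj (p ^^ n)"
    using assms(1) by (metis inj_fn permutes_inj stable_permutes)
  ultimately show ?thesis
    by (simp add: inj_eq)
qed

lemma above_back_even:
  assumes p: "stable p" and q: "stable q" and ne: "p (p a) \<noteq> a"
    and above: "(p ^^ (2 * n)) a \<in> above p q"
  shows "a \<in> above p q"
  using above
proof (induct n)
  case (Suc n)
  have "p (p ((p ^^ (2 * n)) a)) \<in> above p q"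
    using Suc.prems by simp
  then have "(p ^^ (2 * n)) a \<in> above p q"
    by (rule above_back_two[OF p q, rotated]) (use funpow_period_two[OF p] ne in blast)
  then show ?case
    by (rule Suc.hyps)
qed simp

text \<open>If \<open>a\<close> strictly preferred \<open>inv p a\<close> to \<open>inv q a\<close>,
  the agent two steps before \<open>a\<close> would lie in \<open>above p q\<close>. Propagation
  around the cycle would put \<open>a\<close> there too, although its two successors agree.\<close>

lemma common_arc_pred_le:
  assumes p: "stable p" and q: "stable q" and a: "a \<in> A" and eq: "p a = q a"
    and ne: "p (p a) \<noteq> a"
  shows "u a (inv p a) \<le> u a (inv q a)"
proof (rule ccontr)
  assume less: "\<not> ?thesis"
  let ?d = "inv p a" and ?z = "inv p (inv p a)"
  have d: "?d \<in> A" and z: "?z \<in> A"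
    using a p by simp_all
  have pz: "p (p ?z) = a"
    using p by simp
  have nz: "?z \<noteq> a"
    using ne p by (metis stable_inv_simps(2))
  have "u ?d a \<le> u ?d (inv q ?d)"
    using stable_T2[OF q a d] less by simp
  moreover have "u ?d ?z < u ?d a"
    using stable_T1[OF p d] nz u_eq_iff[of ?d ?z a] a d z p by auto
  ultimately have "?d \<in> above (inv q) (inv p)"
    using d by (simp add: above_def)
  then have above_z: "?z \<in> above p q"
    using succ_above_iff(1)[OF p q, of ?z] p by simp
  obtain n where n: "n > 0" "(p ^^ n) a = a"
    using stable_self_in_orbit[OF p, of a] by (auto simp: orbit_altdef)
  \<comment> \<open>Two rounds give an even period whatever the parity of \<open>n\<close>, so
    \<open>?z\<close> is also an even number of steps after \<open>a\<close>.\<close>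
  have per: "(p ^^ (2 * n)) a = a"
    using n by (simp add: mult_2 funpow_add)
  obtain m where m: "n = Suc m"
    using n by (metis gr0_implies_Suc)
  have "p (p ((p ^^ (2 * m)) a)) = a"
    using per m by simp
  then have "?z = (p ^^ (2 * m)) a"
    using p by (metis stable_inv_simps(1))
  then have "a \<in> above p q"
    using above_back_even[OF p q ne, of m] above_z by simp
  then show False
    using eq by (simp add: above_def)
qed

text \<open>Using \<open>common_arc_pred_le\<close> in both directions, the set \<open>B\<close> of
  common arcs on long cycles is closed under predecessors. As \<open>B\<close> is finite and
  \<open>inv p\<close> injective, it is closed under successors as well.\<close>

lemma common_arc_orbit:
  assumes p: "stable p" and q: "stable q" and a: "a \<in> A" and eq: "p a = q a"
    and np: "p (p a) \<noteq> a" and nq: "q (q a) \<noteq> a"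
  shows "orbit p a = orbit q a \<and> (\<forall>x\<in>orbit p a. p x = q x)"
proof -
  define B where "B = {x \<in> A. p x = q x \<and> p (p x) \<noteq> x \<and> q (q x) \<noteq> x}"
  have pred_B: "inv p x \<in> B" if "x \<in> B" for x
  proof -
    have x: "x \<in> A" "p x = q x" "p (p x) \<noteq> x" "q (q x) \<noteq> x"
      using that by (auto simp: B_def)
    have "u x (inv p x) = u x (inv q x)"
      using common_arc_pred_le[OF p q x(1,2,3)] common_arc_pred_le[OF q p x(1) x(2)[symmetric] x(4)]
      by simp
    then have inv_eq: "inv p x = inv q x"
      using x(1) p q by (simp add: u_eq_iff)
    then show ?thesis
      unfolding B_def using x p q by (auto, (metis stable_inv_simps)+)
  qed
  have finB: "finite B"
    using finite_A by (simp add: B_def)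
  have "inj_on (inv p) B"
    using p by (metis inj_onI stable_inv_simps(2))
  then have "inv p ` B = B"
    using pred_B by (intro endo_inj_surj[OF finB]) auto
  then have closed: "p x \<in> B" if "x \<in> B" for x
    using that p by (metis imageE stable_inv_simps(2))
  have aB: "a \<in> B"
    using a eq np nq by (simp add: B_def)
  have "x \<in> B" if "x \<in> orbit p a" for x
    using that by induct (auto intro: closed aB)
  moreover have "orbit p a = orbit q a"
    by (rule orbit_cong0[OF aB]) (auto simp: closed, simp add: B_def)
  ultimately show ?thesis
    by (auto simp: B_def)
qed

lemma odd_period_eq:
  assumes p: "stable p" and q: "stable q" and a: "a \<in> A" and k: "odd k" "(p ^^ k) a = a"
  shows "q a = p a"
proof (cases "p (p a) = a")
  case True
  \<comment> \<open>Period two together with an odd period leaves only a fixed point.\<close>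
  then have "(p ^^ (2 * m)) a = a" for m
    by (induct m) auto
  moreover obtain m where "k = Suc (2 * m)"
    using k(1) by (metis oddE Suc_eq_plus1)
  ultimately have fix_a: "p a = a"
    using k(2) by simp
  show ?thesis
  proof (rule ccontr)
    assume "q a \<noteq> p a"
    then have "inv q a \<noteq> a"
      using q fix_a by (metis stable_inv_simps(2))
    then have "u a a < u a (inv q a)"
      using self_least[OF a, of "inv q a"] u_eq_iff[of a a "inv q a"] a q by auto
    moreover have "inv p a = a"
      using fix_a p by (metis stable_inv_simps(1))
    ultimately have "p a \<in> above (inv q) (inv p)"
      using a fix_a by (simp add: above_def)
    then have "a \<in> above p q"
      using succ_above_iff(1)[OF p q] by simp
    then show False
      using self_least[OF a, of "q a"] fix_a a q by (simp add: above_def)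
  qed
next
  case ne: False
  \<comment> \<open>From the predecessor of \<open>x\<close>, the even number \<open>Suc k\<close>
    of steps ends at \<open>x\<close>, so the predecessor is in \<open>above p q\<close> too. Then
    \<open>x\<close> prefers \<open>inv q x\<close> to \<open>inv p x\<close>, which is at least as
    good as \<open>q x\<close>, against (T1) for \<open>q\<close>.\<close>
  have never: "x \<notin> above p q" if x: "p (p x) \<noteq> x" "(p ^^ k) x = x" for x
  proof
    assume x_above: "x \<in> above p q"
    let ?y = "inv p x"
    have "p ((p ^^ k) ?y) = x"
      using x(2) p by (metis funpow_swap1 stable_inv_simps(2))
    then have y_per: "(p ^^ k) ?y = ?y"
      using p by (metis stable_inv_simps(1))
    have y_ne: "p (p ?y) \<noteq> ?y"
      using x(1) p by (metis stable_inv_simps(2))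
    obtain m where m: "Suc k = 2 * m"
      using k(1) by (metis dvdE even_Suc)
    have "(p ^^ Suc k) ?y = x"
      using y_per p by simp
    then have "(p ^^ (2 * m)) ?y \<in> above p q"
      using m x_above by simp
    then have "?y \<in> above p q"
      by (rule above_back_even[OF p q y_ne])
    then have "x \<in> above (inv q) (inv p)"
      using succ_above_iff(1)[OF p q, of ?y] p by simp
    then show False
      using above_le_pred[OF p q x_above] stable_T1[OF q, of x] x_above by (auto simp: above_def)
  qed
  show ?thesis
  proof (rule ccontr)
    assume "q a \<noteq> p a"
    then have "u a (q a) \<noteq> u a (p a)"
      using a p q by (simp add: u_eq_iff)
    moreover have "a \<notin> above p q"
      using never ne k(2) by blast
    \<comment> \<open>The opposite preference at \<open>a\<close> also produces a member of
      \<open>above p q\<close>, namely the predecessor of \<open>a\<close>.\<close>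
    ultimately have "a \<in> above q p"
      using a by (auto simp: above_def)
    then have "u a (p a) \<le> u a (inv q a)"
      by (rule above_le_pred[OF q p])
    moreover have "inv p a \<noteq> p a"
      using ne p by (metis stable_inv_simps(2))
    then have "u a (inv p a) < u a (p a)"
      using stable_T1[OF p a] u_eq_iff[of a "inv p a" "p a"] a p by auto
    ultimately have "p (inv p a) \<in> above (inv q) (inv p)"
      using a p by (simp add: above_def)
    then have "inv p a \<in> above p q"
      using succ_above_iff(1)[OF p q] by simp
    moreover have "p (p (inv p a)) \<noteq> inv p a"
      using ne p by (metis stable_inv_simps(2))
    moreover have "(p ^^ k) (inv p a) = inv p a"
      using k(2) p by (metis funpow_swap1 stable_inv_simps)
    ultimately show False
      using never by blast
  qed
qed

text \<open>All agents of the orbit share it, so its odd size is a period of each of them and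
  \<open>odd_period_eq\<close> applies throughout.\<close>

lemma odd_orbit_eq:
  assumes p: "stable p" and q: "stable q" and a: "a \<in> A" and "odd (card (orbit p a))"
  shows "orbit p a = orbit q a \<and> (\<forall>x\<in>orbit p a. p x = q x)"
proof -
  have perm: "permutation p"
    using p finite_A permutation_permutes stable_permutes by blast
  have eq: "p x = q x" if "x \<in> orbit p a" for x
  proof -
    have "orbit p x = orbit p a"
      using that perm cyclic_on_orbit' orbit_cyclic_eq3 by metis
    then have "odd (card (orbit p x))"
      using assms(4) by simp
    moreover have "x \<in> A"
      using that a permutes_orbit_subset[OF stable_permutes[OF p]] by blast
    ultimately show ?thesis
      using odd_period_eq[OF p q _ _ funpow_card_orbit] stable_self_in_orbit[OF p] by metis
  qed
  moreover have "orbit q a = orbit p a"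
    using stable_self_in_orbit[OF p] eq by (intro orbit_cong) auto
  ultimately show ?thesis
    by simp
qed

end

subsection \<open>Ranks of a stable roommates instance\<close>

text \<open>Counting the agents below \<open>b\<close> makes larger values better; in an instance
  each agent gives itself the value 0.\<close>

definition pref_rank :: "'a set \<Rightarrow> ('a \<Rightarrow> 'a rel) \<Rightarrow> 'a \<Rightarrow> 'a \<Rightarrow> nat" where
  "pref_rank A R a b = card {c \<in> A. prefers A R a b c}"

context
  fixes A :: "'a set" and R :: "'a \<Rightarrow> 'a rel"
  assumes inst: "sr_instance A R"
begin

lemma R_facts:
  assumes "a \<in> A"
  shows "R a \<subseteq> (A - {a}) \<times> (A - {a})" "trans (R a)" "irrefl (R a)" "total_on (A - {a}) (R a)"
  using inst assms by (auto simp: sr_instance_def strict_linear_order_on_def)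

lemma prefers_irrefl: "a \<in> A \<Longrightarrow> \<not> prefers A R a b b"
  using R_facts(3) by (auto simp: prefers_def irrefl_def)

lemma prefers_trans:
  assumes "a \<in> A" "prefers A R a b c" "prefers A R a c d"
  shows "prefers A R a b d"
  using assms R_facts(1,2)[of a] unfolding prefers_def by (blast dest: transD)

lemma prefers_total:
  "a \<in> A \<Longrightarrow> b \<in> A \<Longrightarrow> c \<in> A \<Longrightarrow> b \<noteq> c \<Longrightarrow> prefers A R a b c \<or> prefers A R a c b"
  using R_facts(4)[of a] unfolding prefers_def total_on_def by blast

lemma finite_agents: "finite A"
  using inst by (simp add: sr_instance_def)

lemma pref_rank_less:
  assumes "a \<in> A" "b \<in> A" "c \<in> A" "prefers A R a b c"
  shows "pref_rank A R a c < pref_rank A R a b"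
  unfolding pref_rank_def
proof (rule psubset_card_mono)
  show "{d \<in> A. prefers A R a c d} \<subset> {d \<in> A. prefers A R a b d}"
    using assms prefers_trans prefers_irrefl by blast
qed (simp add: finite_agents)

lemma prefers_iff_rank:
  "a \<in> A \<Longrightarrow> b \<in> A \<Longrightarrow> c \<in> A \<Longrightarrow> prefers A R a b c \<longleftrightarrow> pref_rank A R a c < pref_rank A R a b"
  using pref_rank_less prefers_total by (metis less_asym less_irrefl)

lemma ranking_pref_rank: "ranking A (pref_rank A R)"
proof
  show "inj_on (pref_rank A R a) A" if "a \<in> A" for a
    using that prefers_total pref_rank_less by (metis inj_onI less_irrefl)
  show "pref_rank A R a a \<le> pref_rank A R a b" if "a \<in> A" "b \<in> A" for a b
  proof (cases "a = b")
    case False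
    then have "prefers A R a b a"
      using that by (simp add: prefers_def)
    then show ?thesis
      using that pref_rank_less by (simp add: order_less_imp_le)
  qed simp
qed (rule finite_agents)

interpretation ranking A "pref_rank A R"
  by (rule ranking_pref_rank)

lemma stable_partition_imp_stable:
  assumes sp: "stable_partition A R p"
  shows "stable p"
proof -
  have perm: "p permutes A"
    and T1: "\<And>a. a \<in> A \<Longrightarrow> weakly_prefers A R a (p a) (inv p a)"
    and T2: "\<And>a b. a \<in> A \<Longrightarrow> b \<in> A \<Longrightarrow> a \<noteq> b \<Longrightarrow> prefers A R a b (inv p a) \<Longrightarrow>
      \<not> prefers A R b a (inv p b)"
    using sp unfolding stable_partition_def by blast+
  have inA: "p a \<in> A" "inv p a \<in> A" if "a \<in> A" for a
    using perm that by (metis permutes_in_image permutes_inv)+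
  show ?thesis
    unfolding stable_def
  proof (intro conjI ballI impI)
    show "pref_rank A R a (inv p a) \<le> pref_rank A R a (p a)" if "a \<in> A" for a
      using T1[OF that] that inA pref_rank_less unfolding weakly_prefers_def
      by (metis order_less_imp_le order_refl)
    fix a b
    assume a: "a \<in> A" and b: "b \<in> A" and less: "pref_rank A R a (inv p a) < pref_rank A R a b"
    \<comment> \<open>The premise fails for \<open>b = a\<close> because \<open>a\<close> ranks
      itself lowest; this supplies the distinctness in (T2).\<close>
    then have "a \<noteq> b"
      using self_least[OF a, of "inv p a"] inA by auto
    then show "pref_rank A R b a \<le> pref_rank A R b (inv p b)"
      using T2[OF a b] a b inA less prefers_iff_rank by (metis not_less)
  qed (rule perm)
qed

subsection \<open>Counting stable cycles\<close>

text \<open>All points of an orbit have the same orbit, so a cycle can be rebased at any of its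
  arcs. Two cycles through \<open>x\<close> can then be compared through their orbits at
  \<open>x\<close>.\<close>

lemma stable_cycleE:
  assumes "c \<in> stable_cycles A R" "(x, y) \<in> c"
  obtains p where "stable p" "x \<in> A" "y = p x" "c = {(z, p z) | z. z \<in> orbit p x}"
    "card c = card (orbit p x)"
proof -
  obtain p a where p: "stable_partition A R p" and a: "a \<in> A"
    and c: "c = {(z, p z) | z. z \<in> orbit p a}"
    using assms(1) by (auto simp: stable_cycles_def cycles_of_def)
  have st: "stable p"
    using p by (rule stable_partition_imp_stable)
  have x: "x \<in> orbit p a" "y = p x"
    using assms(2) c by auto
  have "permutation p"
    using st finite_agents permutation_permutes stable_permutes by blast
  then have "orbit p x = orbit p a"
    using x(1) cyclic_on_orbit' orbit_cyclic_eq3 by metis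
  moreover have "x \<in> A"
    using x(1) a permutes_orbit_subset[OF stable_permutes[OF st]] by blast
  ultimately show thesis
    using that[OF st] x(2) c card_orbit_graph[of p x] by simp
qed

lemma FieldE_stable_cycle:
  assumes "c \<in> stable_cycles A R" "x \<in> Field c"
  obtains y where "(x, y) \<in> c"
proof -
  obtain w z where wz: "(w, z) \<in> c" "x = w \<or> x = z"
    using assms(2) by (auto simp: Field_def)
  obtain p where "z = p w" "c = {(z, p z) | z. z \<in> orbit p w}"
    by (rule stable_cycleE[OF assms(1) wz(1)])
  then show thesis
    using wz that by (auto intro: orbit.base)
qed

lemma stable_cycle_nonempty: "c \<in> stable_cycles A R \<Longrightarrow> c \<noteq> {}"
  by (auto simp: stable_cycles_def cycles_of_def orbit_nonempty)

text \<open>With \<open>d\<close> of arbitrary parity, this yields both the disjointness of odd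
  cycles and the fact that even cycles avoid their agents.\<close>

lemma odd_cycle_unique:
  assumes c: "c \<in> odd_cycles A R" and d: "d \<in> stable_cycles A R"
    and xc: "x \<in> Field c" and xd: "x \<in> Field d"
  shows "c = d"
proof -
  have cs: "c \<in> stable_cycles A R" and odd: "odd (card c)"
    using c by (auto simp: odd_cycles_def)
  obtain y where y: "(x, y) \<in> c"
    using FieldE_stable_cycle[OF cs xc] .
  obtain z where z: "(x, z) \<in> d"
    using FieldE_stable_cycle[OF d xd] .
  obtain p where p: "stable p" "x \<in> A" "y = p x" "c = {(z, p z) | z. z \<in> orbit p x}"
    "card c = card (orbit p x)"
    by (rule stable_cycleE[OF cs y])
  obtain q where q: "stable q" "x \<in> A" "z = q x" "d = {(z, q z) | z. z \<in> orbit q x}"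
    "card d = card (orbit q x)"
    by (rule stable_cycleE[OF d z])
  have "orbit p x = orbit q x \<and> (\<forall>x\<in>orbit p x. p x = q x)"
    using odd_orbit_eq[OF p(1) q(1) p(2)] odd p(5) by simp
  then show ?thesis
    unfolding p(4) q(4) by auto
qed

text \<open>Disjointness makes the choice of one agent per odd cycle injective.\<close>

lemma card_odd_cycles_le: "card (odd_cycles A R) \<le> card (odd_cycle_agents A R)"
proof -
  define f where "f c = (SOME x. x \<in> Field c)" for c :: "'a rel"
  have f: "f c \<in> Field c" if "c \<in> odd_cycles A R" for c
  proof -
    have "Field c \<noteq> {}"
      using that stable_cycle_nonempty by (fastforce simp: odd_cycles_def Field_def)
    then show ?thesis
      unfolding f_def using some_in_eq by blast
  qed
  show ?thesis
  proof (rule card_inj_on_le)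
    show "inj_on f (odd_cycles A R)"
    proof (rule inj_onI)
      fix c d assume c: "c \<in> odd_cycles A R" and d: "d \<in> odd_cycles A R" and "f c = f d"
      then have "f c \<in> Field d"
        using f by simp
      then show "c = d"
        using odd_cycle_unique[OF c _ f[OF c]] d by (auto simp: odd_cycles_def)
    qed
    show "f ` odd_cycles A R \<subseteq> odd_cycle_agents A R"
      using f by (auto simp: odd_cycle_agents_def)
    show "finite (odd_cycle_agents A R)"
      using odd_cycle_agents_subset finite_agents by (rule finite_subset)
  qed
qed

text \<open>An arc may lie on a transposition in one stable partition and on a longer cycle in
  another, hence the hypothesis \<open>two\<close>. A transposition is given by its arc; longer
  cycles are covered by \<open>common_arc_orbit\<close>.\<close>

lemma even_cycle_determined:
  assumes c: "c \<in> stable_cycles A R" "even (card c)" and d: "d \<in> stable_cycles A R" "even (card d)"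
    and x: "(x, y) \<in> c" "(x, y) \<in> d" and two: "card c = 2 \<longleftrightarrow> card d = 2"
  shows "c = d"
proof -
  obtain p where p: "stable p" "x \<in> A" "y = p x" "c = {(z, p z) | z. z \<in> orbit p x}"
    "card c = card (orbit p x)"
    using stable_cycleE[OF c(1) x(1)] .
  obtain q where q: "stable q" "y = q x" "d = {(z, q z) | z. z \<in> orbit q x}"
    "card d = card (orbit q x)"
    using stable_cycleE[OF d(1) x(2)] .
  have pos: "card (orbit r x) > 0" if "stable r" for r
    using that stable_self_in_orbit by (metis card_gt_0_iff empty_iff finite_orbit)
  \<comment> \<open>If two steps return to \<open>x\<close>, the orbit has at most two points, and
    even size excludes a fixed point.\<close>
  have two_iff: "card (orbit r x) = 2 \<longleftrightarrow> r (r x) = x"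
    if "stable r" "even (card (orbit r x))" for r
  proof
    assume "card (orbit r x) = 2"
    then show "r (r x) = x"
      using funpow_card_orbit[OF stable_self_in_orbit[OF that(1)], of x]
      by (simp add: numeral_2_eq_2)
  next
    assume "r (r x) = x"
    then show "card (orbit r x) = 2"
      using card_orbit_involutive[of r x] pos[OF that(1)] that(2)
      by (metis One_nat_def Suc_leI le_antisym not_less_eq_eq numeral_2_eq_2 odd_one)
  qed
  have two_p: "card c = 2 \<longleftrightarrow> p (p x) = x" and two_q: "card d = 2 \<longleftrightarrow> q (q x) = x"
    unfolding p(5) q(4) using two_iff[OF p(1)] two_iff[OF q(1)] c(2) d(2) p(5) q(4) by metis+
  have "orbit p x = orbit q x \<and> (\<forall>z\<in>orbit p x. p z = q z)"
  proof (cases "card c = 2")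
    case True
    then have "p (p x) = x" "q (q x) = x"
      using two two_p two_q by blast+
    then have "p (p x) = q (p x)"
      using p(3) q(2) by simp
    have "z \<in> {x, p x}" if "z \<in> orbit p x" for z
      using that by induct (auto simp: \<open>p (p x) = x\<close>)
    then have eq: "p z = q z" if "z \<in> orbit p x" for z
      using that p(3) q(2) \<open>p (p x) = q (p x)\<close> by blast
    moreover have "orbit q x = orbit p x"
      using stable_self_in_orbit[OF p(1)] eq by (intro orbit_cong) auto
    ultimately show ?thesis
      by simp
  next
    case False
    then have "p (p x) \<noteq> x" "q (q x) \<noteq> x"
      using two two_p two_q by blast+
    then show ?thesis
      using common_arc_orbit[OF p(1) q(1) p(2) trans[OF p(3)[symmetric] q(2)]] by blast
  qed
  then show ?thesis
    unfolding p(4) q(3) by auto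
qed

text \<open>Each even cycle is encoded by one of its arcs, which joins agents outside all odd
  cycles, and a flag for length two. The flag accounts for the factor 2.\<close>

lemma card_even_cycles_le:
  "card {c \<in> stable_cycles A R. even (card c)} \<le> 2 * (card A - card (odd_cycle_agents A R))\<^sup>2"
proof -
  let ?E = "{c \<in> stable_cycles A R. even (card c)}" and ?B = "A - odd_cycle_agents A R"
  define f where "f c = (SOME e. e \<in> c)" for c :: "'a rel"
  have f: "f c \<in> c" if "c \<in> ?E" for c
    using that stable_cycle_nonempty some_in_eq unfolding f_def by blast
  have sub: "c \<subseteq> ?B \<times> ?B" if "c \<in> ?E" for c
  proof -
    have "Field c \<inter> odd_cycle_agents A R = {}"
      using that odd_cycle_unique unfolding odd_cycle_agents_def odd_cycles_def by blast
    then show ?thesis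
      using that stable_cycle_subset by (fastforce simp: Field_def)
  qed
  have fin: "finite ?B"
    using finite_agents by simp
  have "card ?E \<le> card ((?B \<times> ?B) \<times> (UNIV :: bool set))"
  proof (rule card_inj_on_le)
    show "inj_on (\<lambda>c. (f c, card c = 2)) ?E"
    proof (rule inj_onI)
      fix c d assume c: "c \<in> ?E" and d: "d \<in> ?E" and "(f c, card c = 2) = (f d, card d = 2)"
      then have "f c = f d" "card c = 2 \<longleftrightarrow> card d = 2"
        by auto
      then show "c = d"
        using even_cycle_determined[of c d "fst (f c)" "snd (f c)"] c d f[OF c] f[OF d] by simp
    qed
    show "(\<lambda>c. (f c, card c = 2)) ` ?E \<subseteq> (?B \<times> ?B) \<times> UNIV"
      using subsetD[OF sub f] by blast
  qed (use fin in simp)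
  also have "\<dots> = 2 * (card A - card (odd_cycle_agents A R))\<^sup>2"
    using finite_subset[OF odd_cycle_agents_subset finite_agents, of R]
    by (simp add: card_cartesian_product card_Diff_subset odd_cycle_agents_subset power2_eq_square)
  finally show ?thesis .
qed

lemma card_stable_cycles_le:
  "card (stable_cycles A R)
    \<le> 2 * (card A - card (odd_cycle_agents A R))\<^sup>2 + card (odd_cycle_agents A R)"
proof -
  have "stable_cycles A R = {c \<in> stable_cycles A R. even (card c)} \<union> odd_cycles A R"
    by (auto simp: odd_cycles_def)
  then have "card (stable_cycles A R)
      \<le> card {c \<in> stable_cycles A R. even (card c)} + card (odd_cycles A R)"
    by (metis card_Un_le)
  then show ?thesis
    using card_even_cycles_le card_odd_cycles_le by linarith
qed

end

theorem theorem33: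
  shows "\<exists>C C' :: nat. \<forall>(A :: 'a set) R n n1 n2.
    sr_instance A R \<longrightarrow> n = card A \<longrightarrow> n2 = card (odd_cycle_agents A R) \<longrightarrow> n1 = n - n2 \<longrightarrow>
      card (stable_cycles A R) \<le> C * (n1\<^sup>2 + n2) \<and> n1\<^sup>2 + n2 \<le> C' * n\<^sup>2"
proof (intro exI allI impI conjI)
  fix A :: "'a set" and R n n1 n2
  assume inst: "sr_instance A R" and n: "n = card A" and n2: "n2 = card (odd_cycle_agents A R)"
    and n1: "n1 = n - n2"
  \<comment> \<open>The witness \<open>C = 2\<close> is the factor from the even cycles; the odd
    cycles contribute only \<open>n2\<close>.\<close>
  show "card (stable_cycles A R) \<le> 2 * (n1\<^sup>2 + n2)"
    using card_stable_cycles_le[OF inst] n n1 n2 by simp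
  have "n2 \<le> n"
    unfolding n n2 using finite_agents[OF inst] odd_cycle_agents_subset by (rule card_mono)
  then have "n\<^sup>2 = n1\<^sup>2 + n2\<^sup>2 + 2 * n1 * n2"
    using n1 by (metis le_add_diff_inverse2 power2_sum)
  moreover have "n2 \<le> n2\<^sup>2"
    by (simp add: power2_eq_square)
  ultimately show "n1\<^sup>2 + n2 \<le> 1 * n\<^sup>2"
    by simp
qed

end
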